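(* Let $V$ be a real vector space with linear dual $V^{\#}$, and let $f_1,f_2\colon V\to\overline{\mathbb{R}}$ be arbitrary functions. Then $$\sup_{x\in V}\{f_2(x)-f_1(x)\}\ \ge\ \sup_{k\in V^{\#}}\{f_1^{\star}(k)-f_2^{\star}(k)\},$$ where $f_i^{\star}\colon V^{\#}\to\overline{\mathbb{R}}$ is the Legendre-Fenchel transform of $f_i$.
   Context: $\overline{\mathbb{R}}=[-\infty,+\infty]$. Addition on $\overline{\mathbb{R}}$ extends that of $\mathbb{R}$ by $(+\infty)+y=y+(+\infty)=+\infty$ for all $y\in\overline{\mathbb{R}}$ (including $y=-\infty$) and $(-\infty)+y=y+(-\infty)=-\infty$ for all $y<+\infty$. Subtraction on $\overline{\mathbb{R}}$ is defined by $c-b:=\inf\{a\in\overline{\mathbb{R}}\mid a+b\ge c\}$. Thus it is the usual subtraction on finite values; $c-(+\infty)=-\infty$ for every $c$; $(-\infty)-b=-\infty$ for every $b$; $c-(-\infty)=+\infty$ for every $c>-\infty$; $(+\infty)-b=+\infty$ for every $b<+\infty$. In particular $(+\infty)-(+\infty)=-\infty=(-\infty)-(-\infty)$. For $x\in V$ and $k\in V^{\#}$ write $\langle x,k\rangle:=k(x)\in\mathbb{R}$. For $f\colon V\to\overline{\mathbb{R}}$ the Legendre-Fenchel transform is $$f^{\star}(k):=\sup_{x\in V}\{\langle x,k\rangle-f(x)\}\qquad(k\in V^{\#}).$$ *)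

theory Defs
  imports Complex_Main "HOL-Library.Extended_Real"
begin

text \<open>
  Addition on \<^typ>\<open>ereal\<close> already lets \<open>\<infinity>\<close> absorb \<open>-\<infinity>\<close>. The library subtraction
  \<open>c - b = c + (- b)\<close>, however, gives \<open>\<infinity> - \<infinity> = \<infinity> = (-\<infinity>) - (-\<infinity>)\<close>, whereas the
  residual of addition used here gives \<open>-\<infinity>\<close> in both cases.
\<close>

definition ereal_residual :: "ereal \<Rightarrow> ereal \<Rightarrow> ereal"  (infixl \<open>\<ominus>\<close> 65)
  where "c \<ominus> b = Inf {a. a + b \<ge> c}"

lemma ereal_residual_values:
  "ereal r \<ominus> ereal s = ereal (r - s)"
  "c \<ominus> \<infinity> = -\<infinity>"
  "-\<infinity> \<ominus> b = -\<infinity>"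
  "c > -\<infinity> \<Longrightarrow> c \<ominus> -\<infinity> = \<infinity>"
  "b < \<infinity> \<Longrightarrow> \<infinity> \<ominus> b = \<infinity>"
proof -
  have "{a. a + ereal s \<ge> ereal r} = {ereal (r - s)..}"
  proof (intro set_eqI)
    fix a show "a \<in> {a. a + ereal s \<ge> ereal r} \<longleftrightarrow> a \<in> {ereal (r - s)..}"
      by (cases a) auto
  qed
  then show "ereal r \<ominus> ereal s = ereal (r - s)"
    by (simp add: ereal_residual_def)
  show "c \<ominus> \<infinity> = -\<infinity>"
    by (simp add: ereal_residual_def bot_ereal_def)
  show "-\<infinity> \<ominus> b = -\<infinity>"
    by (simp add: ereal_residual_def bot_ereal_def)
  show "c \<ominus> -\<infinity> = \<infinity>" if "c > -\<infinity>"
  proof -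
    have "{a. a + -\<infinity> \<ge> c} = {\<infinity>}"
    proof (intro set_eqI)
      fix a show "a \<in> {a. a + -\<infinity> \<ge> c} \<longleftrightarrow> a \<in> {\<infinity>}"
        using that by (cases a) auto
    qed
    then show ?thesis by (simp add: ereal_residual_def)
  qed
  show "\<infinity> \<ominus> b = \<infinity>" if "b < \<infinity>"
  proof -
    have "{a. a + b \<ge> \<infinity>} = {\<infinity>}"
    proof (intro set_eqI)
      fix a show "a \<in> {a. a + b \<ge> \<infinity>} \<longleftrightarrow> a \<in> {\<infinity>}"
        using that by (cases a; cases b) auto
    qed
    then show ?thesis by (simp add: ereal_residual_def)
  qed
qed

definition linear_dual :: "('v::real_vector \<Rightarrow> real) set"
  where "linear_dual = {k. linear k}"

text \<open>The transform is only meaningful at arguments \<open>k \<in> linear_dual\<close>.\<close>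

definition legendre_fenchel ::
    "('v::real_vector \<Rightarrow> ereal) \<Rightarrow> ('v \<Rightarrow> real) \<Rightarrow> ereal"
  where "legendre_fenchel f k = (SUP x. ereal (k x) \<ominus> f x)"

end

theory Submission imports Defs
begin

text \<open>
  Residuation turns every subtraction into an addition: \<open>c \<ominus> b\<close> is the least \<open>a\<close> with
  \<open>c \<le> a + b\<close>, for all infinite values too. With \<open>M = sup (f2 \<ominus> f1)\<close> one has
  \<open>f2 \<le> M + f1\<close>, hence \<open>k \<le> (k \<ominus> f2) + f2 \<le> M + (k \<ominus> f2) + f1\<close> pointwise, that is
  \<open>k \<ominus> f1 \<le> M + (k \<ominus> f2)\<close>; take suprema.
\<close>

text \<open>The infimum defining the residual is attained. For infinite \<open>b\<close> this rests
  on \<infinity> absorbing -\<infinity> in sums: the right side is then \<infinity>, or both sides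
  are -\<infinity>.\<close>

lemma le_ereal_residual_add: "c \<le> (c \<ominus> b) + b"
  by (cases c; cases b) (simp_all add: ereal_residual_values)

lemma ereal_residual_le_iff: "c \<ominus> b \<le> a \<longleftrightarrow> c \<le> a + b"
proof
  assume "c \<ominus> b \<le> a"
  then show "c \<le> a + b"
    using le_ereal_residual_add[of c b] add_right_mono order_trans by blast
next
  assume "c \<le> a + b"
  then show "c \<ominus> b \<le> a"
    by (auto simp: ereal_residual_def intro: Inf_lower)
qed

text \<open>A triangle inequality for \<open>\<ominus>\<close>: passing from \<open>b\<close> to
  \<open>d\<close> through \<open>c\<close> costs at most the sum of the two residuals.\<close>

lemma ereal_residual_antimono_add:
  assumes "c \<ominus> b \<le> m"
  shows "d \<ominus> b \<le> m + (d \<ominus> c)"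
proof -
  have "d \<le> (d \<ominus> c) + c"
    by (rule le_ereal_residual_add)
  also have "\<dots> \<le> (d \<ominus> c) + (m + b)"
    using assms by (intro add_left_mono) (simp add: ereal_residual_le_iff)
  finally show ?thesis
    by (simp add: ereal_residual_le_iff ac_simps)
qed

text \<open>Any upper bound \<open>m\<close> is allowed, so the theorem can take the supremum of
  \<open>f2 x \<ominus> f1 x\<close> itself as \<open>m\<close>.\<close>

lemma legendre_fenchel_residual_le:
  assumes "\<And>x. f2 x \<ominus> f1 x \<le> m"
  shows "legendre_fenchel f1 k \<ominus> legendre_fenchel f2 k \<le> m"
proof -
  have "ereal (k x) \<ominus> f1 x \<le> m + legendre_fenchel f2 k" for x
  proof -
    have "ereal (k x) \<ominus> f1 x \<le> m + (ereal (k x) \<ominus> f2 x)"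
      using assms by (rule ereal_residual_antimono_add)
    also have "\<dots> \<le> m + legendre_fenchel f2 k"
      unfolding legendre_fenchel_def by (intro add_left_mono SUP_upper UNIV_I)
    finally show ?thesis .
  qed
  then have "legendre_fenchel f1 k \<le> m + legendre_fenchel f2 k"
    unfolding legendre_fenchel_def[of f1] by (rule SUP_least)
  then show ?thesis
    by (simp add: ereal_residual_le_iff)
qed

theorem theorem3:
  fixes f1 f2 :: "'v::real_vector \<Rightarrow> ereal"
  shows "(SUP x. f2 x \<ominus> f1 x)
       \<ge> (SUP k\<in>linear_dual. legendre_fenchel f1 k \<ominus> legendre_fenchel f2 k)"
  by (intro SUP_least legendre_fenchel_residual_le SUP_upper UNIV_I)

end
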